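(* Let $Y=G^{(Q)}_{\mu,\nu;a,b}$ be an Integral Grand Lebesgue Space, let $\phi_Y$ be its fundamental function, and put $$\zeta(\lambda)=\zeta_Y(\lambda)=\phi_Y^Q\left(e^{\lambda/Q}\right)=\int_{[a,b]}e^{\lambda/p}\,\nu(dp),\qquad\lambda\in(-\infty,\infty).$$ Let $\nu([a,b])<\infty$. (A) The function $\zeta_Y(\lambda)$ is absolutely monotonic on the set $\lambda\in(-\infty,\infty)$: $$\zeta^{(k)}(\lambda)>0,\qquad k=0,1,2,\ldots,$$ and is such that $$C_1e^{\lambda/b}\le\zeta(\lambda)\le C_2e^{\lambda/a}.$$ The class of functions on $(-\infty,\infty)$ satisfying these two conditions is denoted by $AM=AM(a,b)$; any function from the class $AM(a,b)$ is infinitely differentiable on the whole real axis. (B) Conversely, if a function $\lambda\to\zeta(\lambda)$, defined on the set $\lambda\in(-\infty,\infty)$, satisfies the two conditions $\zeta^{(k)}(\lambda)>0$, $k=0,1,2,\ldots$, and $C_1e^{\lambda/b}\le\zeta(\lambda)\le C_2e^{\lambda/a}$, then there exists a finite Borel measure $\nu$ on the closed interval $[a,b]$ for which $$\zeta(\lambda)=\int_{[a,b]}e^{\lambda/p}\,\nu(dp).$$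
   Context: Let $(T,\mathcal A,\mu)$ be a measurable space with a non-trivial sigma-finite measure $\mu$. For measurable $f:T\to\mathbb R$ put $|f|_p=\left(\int_T|f|^p\,d\mu\right)^{1/p}$, $p\ge1$. Let $1\le a<b\le\infty$, let $Q\ge1$ be a constant and let $\nu$ be a sigma-finite Borel measure on the interval with endpoints $a,b$. The Integral Grand Lebesgue Space $G^{(Q)}_{\mu,\nu;a,b}$ is the set of all measurable $f:T\to\mathbb R$ with finite norm $\left[\int_{[a,b]}|f|_p^Q\,\nu(dp)\right]^{1/Q}$. The norm is assumed order continuous, i.e. functions of the space decreasing to $0$ have norms decreasing to $0$; this holds if $\nu(\{\infty\})=0$ or $b<\infty$. The fundamental function of a rearrangement invariant space $Y$ is $\phi_Y(\delta)=\|I(A)\|_Y$, $\delta\in(0,\infty)$, where $I(A)$ is the indicator function of a measurable set $A$ with $\mu(A)=\delta$; for $Y=G^{(Q)}_{\mu,\nu;a,b}$ one has $\phi_Y^Q(\delta)=\int_{[a,b]}\delta^{Q/p}\,\nu(dp)$. $C_1,C_2$ denote positive finite constants.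
   Formalization: The printed bounds cannot hold for all real λ; here they are required for λ≥0, and for λ≤0 with the two exponentials exchanged (C1 e^{λ/a} ≤ ζ ≤ C2 e^{λ/b}); also ν is non-zero and every δ>0 is the measure of some set. *)

theory Defs
  imports "HOL-Probability.Essential_Supremum"
begin

text \<open>Real powers of extended nonnegative reals, for exponents \<open>r > 0\<close>.\<close>

definition epowr :: "ennreal \<Rightarrow> real \<Rightarrow> ennreal" where
  "epowr x r = (if x = \<infinity> then \<infinity> else ennreal (enn2real x powr r))"

text \<open>The quantity \<open>|f|\<^sub>p\<close>, with values in \<open>[0,\<infinity>]\<close>; the exponent may be infinite, since
  \<open>b = \<infinity>\<close> is allowed below.\<close>

definition Lp_norm :: "'t measure \<Rightarrow> ereal \<Rightarrow> ('t \<Rightarrow> real) \<Rightarrow> ennreal" where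
  "Lp_norm M p f =
     (if p = \<infinity> then esssup M (\<lambda>x. ennreal \<bar>f x\<bar>)
      else epowr (\<integral>\<^sup>+x. ennreal (\<bar>f x\<bar> powr real_of_ereal p) \<partial>M) (1 / real_of_ereal p))"

text \<open>The interval \<open>[a,b]\<close> is the space of the measure \<open>\<nu>\<close>, so integrals over \<open>\<nu>\<close> are
  integrals over \<open>[a,b]\<close>.\<close>

definition IGLS_norm :: "'t measure \<Rightarrow> ereal measure \<Rightarrow> real \<Rightarrow> ('t \<Rightarrow> real) \<Rightarrow> ennreal" where
  "IGLS_norm M \<nu> Q f = epowr (\<integral>\<^sup>+p. epowr (Lp_norm M p f) Q \<partial>\<nu>) (1 / Q)"

definition IGLS :: "'t measure \<Rightarrow> ereal measure \<Rightarrow> real \<Rightarrow> ('t \<Rightarrow> real) set" where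
  "IGLS M \<nu> Q = {f \<in> borel_measurable M. IGLS_norm M \<nu> Q f < \<infinity>}"

definition order_continuous_norm :: "'t measure \<Rightarrow> ereal measure \<Rightarrow> real \<Rightarrow> bool" where
  "order_continuous_norm M \<nu> Q \<longleftrightarrow>
     (\<forall>f :: nat \<Rightarrow> 't \<Rightarrow> real.
        (\<forall>n. f n \<in> IGLS M \<nu> Q) \<longrightarrow>
        (\<forall>x\<in>space M. decseq (\<lambda>n. f n x) \<and> (\<lambda>n. f n x) \<longlonglongrightarrow> 0) \<longrightarrow>
        (\<lambda>n. IGLS_norm M \<nu> Q (f n)) \<longlonglongrightarrow> 0)"

definition fundamental_function :: "'t measure \<Rightarrow> ereal measure \<Rightarrow> real \<Rightarrow> real \<Rightarrow> ennreal" where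
  "fundamental_function M \<nu> Q \<delta> =
     (THE c. \<exists>A\<in>sets M. emeasure M A = ennreal \<delta> \<and> c = IGLS_norm M \<nu> Q (indicat_real A))"

definition zeta :: "'t measure \<Rightarrow> ereal measure \<Rightarrow> real \<Rightarrow> real \<Rightarrow> real" where
  "zeta M \<nu> Q s = enn2real (epowr (fundamental_function M \<nu> Q (exp (s / Q))) Q)"

definition borel_measure_on :: "ereal set \<Rightarrow> ereal measure \<Rightarrow> bool" where
  "borel_measure_on I \<nu> \<longleftrightarrow> sets \<nu> = sets (restrict_space borel I)"

text \<open>Standing assumptions. The assumption \<open>realizable\<close> is what makes the fundamental function
  meaningful on the whole of \<open>(0,\<infinity>)\<close>; \<open>nu_nonzero\<close> is what makes \<open>IGLS_norm\<close> a norm.\<close>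

locale integral_grand_lebesgue =
  fixes M :: "'t measure" and \<nu> :: "ereal measure" and Q :: real and a b :: ereal
  assumes sigma_finite_M: "sigma_finite_measure M"
    and M_nontrivial: "emeasure M (space M) \<noteq> 0"
    and realizable: "\<And>\<delta>. 0 < \<delta> \<Longrightarrow> \<exists>A\<in>sets M. emeasure M A = ennreal \<delta>"
    and a_ge_1: "1 \<le> a" and a_less_b: "a < b" and Q_ge_1: "1 \<le> Q"
    and borel_nu: "borel_measure_on {a..b} \<nu>"
    and sigma_finite_nu: "sigma_finite_measure \<nu>"
    and nu_nonzero: "emeasure \<nu> {a..b} \<noteq> 0"
    and order_continuous: "order_continuous_norm M \<nu> Q"

text \<open>The function \<open>e\<^sup>s\<^sup>/\<^sup>p\<close>; the division takes place in \<^typ>\<open>ereal\<close>, so the value at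
  \<open>p = \<infinity>\<close> is \<open>1\<close>.\<close>

definition exp_div :: "real \<Rightarrow> ereal \<Rightarrow> real" where
  "exp_div s p = exp (real_of_ereal (ereal s / p))"

definition smooth_on_line :: "(real \<Rightarrow> real) \<Rightarrow> bool" where
  "smooth_on_line f \<longleftrightarrow> (\<forall>k. (deriv ^^ k) f differentiable_on UNIV)"

text \<open>All derivatives exist and are positive; the existence is stated explicitly because
  \<^const>\<open>deriv\<close> is total.\<close>

definition strictly_absolutely_monotonic :: "(real \<Rightarrow> real) \<Rightarrow> bool" where
  "strictly_absolutely_monotonic f \<longleftrightarrow>
     (\<forall>k s. (deriv ^^ k) f differentiable at s \<and> 0 < (deriv ^^ k) f s)"

text \<open>The growth bounds \<open>C\<^sub>1 e\<^sup>s\<^sup>/\<^sup>b \<le> \<zeta>(s) \<le> C\<^sub>2 e\<^sup>s\<^sup>/\<^sup>a\<close>. As written they are meant for \<open>s \<ge> 0\<close>, where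
  \<open>e\<^sup>s\<^sup>/\<^sup>b \<le> e\<^sup>s\<^sup>/\<^sup>a\<close>. For \<open>s \<le> 0\<close> the two exponentials are ordered the other way round and
  exchange their roles. Imposing the displayed bounds on the whole line would leave no function
  at all (lemma \<open>whole_line_bounds_unsatisfiable\<close>); imposing them only for \<open>s \<ge> 0\<close> would admit
  \<open>e\<^sup>s\<^sup>/\<^sup>a + 1\<close>, which is not represented by a measure on \<open>[a,b]\<close> when \<open>b < \<infinity>\<close>.\<close>

definition exponential_bounds :: "ereal \<Rightarrow> ereal \<Rightarrow> (real \<Rightarrow> real) \<Rightarrow> bool" where
  "exponential_bounds a b f \<longleftrightarrow>
     (\<exists>C1>0. \<exists>C2>0.
        (\<forall>s\<ge>0. C1 * exp_div s b \<le> f s \<and> f s \<le> C2 * exp_div s a) \<and>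
        (\<forall>s\<le>0. C1 * exp_div s a \<le> f s \<and> f s \<le> C2 * exp_div s b))"

definition AM :: "ereal \<Rightarrow> ereal \<Rightarrow> (real \<Rightarrow> real) set" where
  "AM a b = {f. strictly_absolutely_monotonic f \<and> exponential_bounds a b f}"

lemma exp_div_eq:
  assumes "1 \<le> p"
  shows "exp_div s p = exp (s * real_of_ereal (1 / p))"
  using assms by (cases p) (auto simp: exp_div_def one_ereal_def)

lemma whole_line_bounds_unsatisfiable:
  assumes "1 \<le> a" "a < b" "0 < C1" "0 < C2"
  shows "\<not> (\<forall>s. C1 * exp_div s b \<le> f s \<and> f s \<le> C2 * exp_div s a)"
proof
  assume H: "\<forall>s. C1 * exp_div s b \<le> f s \<and> f s \<le> C2 * exp_div s a"
  define u where "u = real_of_ereal (1 / a)"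
  define t where "t = real_of_ereal (1 / b)"
  have "t < u"
    using assms unfolding u_def t_def
    by (cases a; cases b) (auto simp: one_ereal_def field_simps)
  define l where "l = - (C2 / C1) / (u - t)"
  have "C1 * exp (l * t) \<le> C2 * exp (l * u)"
    using H[rule_format, of l] assms exp_div_eq[of a l] exp_div_eq[of b l]
    unfolding u_def t_def by (auto intro: order_trans)
  then have "exp (l * t) \<le> (C2 / C1) * exp (l * u)"
    using assms by (simp add: field_simps)
  then have "exp (l * t - l * u) \<le> C2 / C1"
    by (simp add: exp_diff field_simps)
  moreover have "l * t - l * u = C2 / C1"
  proof -
    have "l * t - l * u = - l * (u - t)" by (simp add: algebra_simps)
    then show ?thesis using \<open>t < u\<close> unfolding l_def by simp
  qed
  ultimately have "exp (C2 / C1) \<le> C2 / C1" by simp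
  then show False
    using exp_ge_add_one_self[of "C2 / C1"] by linarith
qed

end

theory Submission
  imports Defs "HOL-Probability.Helly_Selection"
begin

text \<open>
For an indicator of a set of measure \<open>\<delta>\<close> the norm \<open>|I(A)|\<^sub>p\<close> is \<open>\<delta>\<^sup>1\<^sup>/\<^sup>p\<close>, so with \<open>\<delta> = e\<^sup>s\<^sup>/\<^sup>Q\<close> the
\<open>Q\<close>-th power of the fundamental function is \<open>\<zeta>(s) = \<integral> e\<^sup>s\<^sup>/\<^sup>p \<nu>(dp)\<close>: a two-sided Laplace transform of
a finite measure in the variable \<open>x = 1 / p\<close>, which runs through \<open>[1/b, 1/a]\<close>, a subset of \<open>[0,1]\<close>.

Differentiating under the integral sign gives \<open>\<zeta>\<^sup>(\<^sup>k\<^sup>)(s) = \<integral> x\<^sup>k e\<^sup>s\<^sup>x\<close>. This is positive for \<open>k \<ge> 1\<close>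
only if \<open>\<nu>\<close> is not concentrated at \<open>p = \<infinity>\<close>, and that follows from the order continuity of the norm
(\<open>AE_finite_exponent\<close>). The exponential bounds hold because \<open>e\<^sup>s\<^sup>x\<close> is monotone in \<open>x\<close>.

The converse is Bernstein's theorem together with a localisation of the support. An absolutely
monotonic function on the whole line is the sum of its Taylor series to the right of every centre
(\<open>strictly_absolutely_monotonic_Taylor_sums\<close>). Expanding at \<open>-n\<close> and substituting
\<open>-n + n e\<^sup>s\<^sup>/\<^sup>n\<close> writes \<open>\<zeta>(-n + n e\<^sup>s\<^sup>/\<^sup>n)\<close> as the Laplace transform of a discrete measure on the
points \<open>k / n\<close>. As \<open>n\<close> grows these transforms converge to \<open>\<zeta>(s)\<close> for every real \<open>s\<close>, so the
measures, normalised by \<open>\<zeta>(0)\<close>, are tight, and a weak limit point has transform \<open>\<zeta> / \<zeta>(0)\<close>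
(\<open>convergent_mgf_imp_mgf\<close>, \<open>Bernstein_whole_line\<close>). The upper exponential bounds for \<open>s \<rightarrow> \<infinity>\<close> and for
\<open>s \<rightarrow> -\<infinity>\<close> confine the limit measure to \<open>[1/b, 1/a]\<close> (\<open>mgf_growth_imp_AE_le\<close>), and its image under
\<open>x \<mapsto> 1 / x\<close> lives on \<open>[a,b]\<close>.
\<close>

section \<open>Taylor series of absolutely monotonic functions\<close>

lemma strictly_absolutely_monotonic_DERIV:
  assumes "strictly_absolutely_monotonic f"
  shows "((deriv ^^ k) f has_real_derivative (deriv ^^ Suc k) f s) (at s)"
proof -
  have "(deriv ^^ k) f differentiable at s"
    using assms by (simp add: strictly_absolutely_monotonic_def)
  then show ?thesis
    by (simp add: DERIV_deriv_iff_real_differentiable)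
qed

lemma strictly_absolutely_monotonic_mono:
  assumes "strictly_absolutely_monotonic f" "x \<le> y"
  shows "(deriv ^^ k) f x \<le> (deriv ^^ k) f y"
proof (rule DERIV_nonneg_imp_nondecreasing[OF \<open>x \<le> y\<close>])
  fix t
  show "\<exists>d. ((deriv ^^ k) f has_real_derivative d) (at t) \<and> 0 \<le> d"
    using strictly_absolutely_monotonic_DERIV[OF assms(1), of k t] assms(1)
    unfolding strictly_absolutely_monotonic_def by (meson less_imp_le)
qed

lemma strictly_absolutely_monotonic_Taylor:
  assumes f: "strictly_absolutely_monotonic f" and n: "0 < n" and h: "0 < h"
  obtains t where "c < t" "t < c + h"
    "f (c + h) = (\<Sum>m<n. (deriv ^^ m) f c / fact m * h ^ m) + (deriv ^^ n) f t / fact n * h ^ n"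
proof -
  have "\<exists>t. c < t \<and> t < c + h \<and>
    f (c + h) = (\<Sum>m<n. ((deriv ^^ m) f c / fact m) * (c + h - c)^m)
      + ((deriv ^^ n) f t / fact n) * (c + h - c)^n"
    by (rule Taylor_up[where a = c])
      (use n h strictly_absolutely_monotonic_DERIV[OF f] in auto)
  then show ?thesis using that by auto
qed

text \<open>The Lagrange remainder of the expansion at \<open>c\<close> with step \<open>h\<close> is compared with the one of the
expansion at \<open>c + h\<close> with step \<open>2 h\<close>. The latter has its derivative evaluated further to the right,
hence is at least \<open>2\<^sup>n\<close> times as large, and it is at most \<open>f (c + 3 h)\<close> because the other Taylor
terms are positive. So the former is at most \<open>f (c + 3 h) / 2\<^sup>n\<close>. This uses the positivity of the derivatives
arbitrarily far to the right.\<close>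

lemma strictly_absolutely_monotonic_Taylor_sums:
  assumes f: "strictly_absolutely_monotonic f" and h: "0 \<le> h"
  shows "(\<lambda>k. (deriv ^^ k) f c / fact k * h ^ k) sums f (c + h)"
proof (cases "h = 0")
  case True
  then show ?thesis
    using powser_sums_zero[of "\<lambda>k. (deriv ^^ k) f c / fact k"] by simp
next
  case False
  with h have h: "0 < h" by simp
  have pos: "0 < (deriv ^^ k) f s" for k s
    using f by (simp add: strictly_absolutely_monotonic_def)
  define r where "r n = f (c + h) - (\<Sum>k<n. (deriv ^^ k) f c / fact k * h ^ k)" for n
  define K where "K = f (c + h + 2 * h)"
  have bound: "0 \<le> r n \<and> r n \<le> K * (1 / 2) ^ n" if n: "0 < n" for n
  proof -
    obtain t where t: "t < c + h" and
      "f (c + h) = (\<Sum>m<n. (deriv ^^ m) f c / fact m * h ^ m) + (deriv ^^ n) f t / fact n * h ^ n"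
      by (rule strictly_absolutely_monotonic_Taylor[OF f n h])
    then have rt: "r n = (deriv ^^ n) f t / fact n * h ^ n"
      unfolding r_def by linarith
    obtain u where u: "c + h < u"
      "K = (\<Sum>m<n. (deriv ^^ m) f (c + h) / fact m * (2 * h) ^ m) + (deriv ^^ n) f u / fact n * (2 * h) ^ n"
      unfolding K_def by (rule strictly_absolutely_monotonic_Taylor[OF f n, of "2 * h" "c + h"]) (use h in auto)
    have "(deriv ^^ n) f t / fact n * h ^ n \<le> (deriv ^^ n) f u / fact n * h ^ n"
      using t u h by (intro mult_right_mono divide_right_mono strictly_absolutely_monotonic_mono[OF f]) auto
    also have "\<dots> = (deriv ^^ n) f u / fact n * (2 * h) ^ n * (1 / 2) ^ n"
      by (simp add: power_mult_distrib power_divide)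
    also have "\<dots> \<le> K * (1 / 2) ^ n"
    proof (rule mult_right_mono)
      have "0 \<le> (\<Sum>m<n. (deriv ^^ m) f (c + h) / fact m * (2 * h) ^ m)"
        using h pos by (intro sum_nonneg mult_nonneg_nonneg divide_nonneg_nonneg) (auto intro: less_imp_le)
      then show "(deriv ^^ n) f u / fact n * (2 * h) ^ n \<le> K"
        using u by simp
    qed simp
    finally have "r n \<le> K * (1 / 2) ^ n" unfolding rt .
    moreover have "0 \<le> r n"
      unfolding rt using h pos[of n t] by (auto intro!: mult_nonneg_nonneg divide_nonneg_nonneg less_imp_le)
    ultimately show ?thesis by simp
  qed
  have "r \<longlonglongrightarrow> 0"
  proof (rule tendsto_sandwich)
    show "\<forall>\<^sub>F n in sequentially. 0 \<le> r n"
      using bound by (auto intro: eventually_sequentiallyI[of 1])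
    show "\<forall>\<^sub>F n in sequentially. r n \<le> K * (1 / 2) ^ n"
      using bound by (auto intro: eventually_sequentiallyI[of 1])
    show "(\<lambda>n. K * (1 / 2) ^ n) \<longlonglongrightarrow> 0"
      by (intro tendsto_mult_right_zero LIMSEQ_realpow_zero) auto
  qed simp
  then have "(\<lambda>n. f (c + h) - r n) \<longlonglongrightarrow> f (c + h) - 0"
    by (intro tendsto_intros)
  then show ?thesis unfolding sums_def r_def by simp
qed

section \<open>Convergence of two-sided Laplace transforms\<close>

lemma real_distributionD:
  assumes "real_distribution M"
  shows "prob_space M" "finite_measure M" "sets M = sets borel" "space M = UNIV"
proof -
  show "prob_space M" by (rule real_distribution.axioms(1)[OF assms])
  then show "finite_measure M" by (rule prob_space.axioms(1))
  show "sets M = sets borel" by (rule real_distribution.events_eq_borel[OF assms])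
  show "space M = UNIV" by (rule real_distribution.space_eq_univ[OF assms])
qed

text \<open>Outside \<open>(-R, R]\<close> the sum \<open>e\<^sup>x + e\<^sup>-\<^sup>x\<close> is at least \<open>R\<close>, so Markov's inequality applies.\<close>

lemma mgf_tail_bound:
  fixes M :: "real measure"
  assumes "real_distribution M" and e: "integrable M (\<lambda>x. exp x)" "integrable M (\<lambda>x. exp (- x))"
    and K: "(\<integral>x. exp x \<partial>M) \<le> K" "(\<integral>x. exp (- x) \<partial>M) \<le> K" and R: "0 < R"
  shows "1 - 2 * K / R \<le> measure M {- R<..R}"
proof -
  note M = real_distributionD[OF \<open>real_distribution M\<close>]
  note [simp, measurable_cong] = M(3)
  note [simp] = M(4)
  have "indicator (- {- R<..R}) x \<le> exp x / R + exp (- x) / R" for x :: real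
  proof (cases "x \<in> {- R<..R}")
    case False
    then have "R \<le> x \<or> R \<le> - x" by auto
    then have "R \<le> exp x + exp (- x)"
      using exp_ge_add_one_self[of x] exp_ge_add_one_self[of "- x"] exp_gt_zero[of x] exp_gt_zero[of "- x"]
      by linarith
    with R False show ?thesis by (simp add: field_simps)
  qed (use R in auto)
  then have "(\<integral>x. indicator (- {- R<..R}) x \<partial>M) \<le> (\<integral>x. exp x / R + exp (- x) / R \<partial>M)"
    using e by (intro integral_mono integrable_real_indicator Bochner_Integration.integrable_add)
      (auto simp: finite_measure.emeasure_eq_measure[OF M(2)])
  also have "\<dots> \<le> 2 * K / R"
  proof -
    have "(\<integral>x. exp x / R + exp (- x) / R \<partial>M) = ((\<integral>x. exp x \<partial>M) + (\<integral>x. exp (- x) \<partial>M)) / R"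
      using e by (simp add: add_divide_distrib)
    then show ?thesis using K R by (simp add: divide_right_mono)
  qed
  finally have "measure M (- {- R<..R}) \<le> 2 * K / R"
    by simp
  moreover have "measure M (- {- R<..R}) = 1 - measure M {- R<..R}"
    using prob_space.prob_compl[OF M(1), of "{- R<..R}"] by (simp add: Compl_eq_Diff_UNIV)
  ultimately show ?thesis by simp
qed

lemma tight_of_convergent_mgf:
  fixes \<mu> :: "nat \<Rightarrow> real measure"
  assumes \<mu>: "\<And>n. real_distribution (\<mu> n)"
    and int: "\<And>n s. integrable (\<mu> n) (\<lambda>x. exp (s * x))"
    and lim: "\<And>s. (\<lambda>n. \<integral>x. exp (s * x) \<partial>\<mu> n) \<longlonglongrightarrow> \<phi> s"
  shows "tight \<mu>"
  unfolding tight_def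
proof (intro conjI allI impI)
  fix \<epsilon> :: real assume \<epsilon>: "0 < \<epsilon>"
  have "Bseq (\<lambda>n. \<integral>x. exp (1 * x) \<partial>\<mu> n)" "Bseq (\<lambda>n. \<integral>x. exp (- 1 * x) \<partial>\<mu> n)"
    using lim[of 1] lim[of "-1"] by (auto intro!: convergent_imp_Bseq simp: convergent_def)
  then obtain K1 K2 where K12: "\<And>n. (\<integral>x. exp (1 * x) \<partial>\<mu> n) \<le> K1" "\<And>n. (\<integral>x. exp (- 1 * x) \<partial>\<mu> n) \<le> K2"
    unfolding Bseq_def by (metis abs_le_D1 real_norm_def)
  define K where "K = max 1 (max K1 K2)"
  define R where "R = 4 * K / \<epsilon>"
  have R: "0 < R" and K: "0 < K" using \<epsilon> unfolding R_def K_def by (auto intro!: divide_pos_pos)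
  have "1 - \<epsilon> < measure (\<mu> n) {- R<..R}" for n
  proof -
    have "1 - 2 * K / R \<le> measure (\<mu> n) {- R<..R}"
      by (rule mgf_tail_bound)
        (use \<mu>[of n] int[of n 1] int[of n "-1"] K12[of n] R in \<open>auto simp: K_def\<close>)
    moreover have "2 * K / R = \<epsilon> / 2" using \<epsilon> K unfolding R_def by simp
    ultimately show ?thesis using \<epsilon> by simp
  qed
  moreover have "- R < R" using R by simp
  ultimately show "\<exists>a b. a < b \<and> (\<forall>n. 1 - \<epsilon> < measure (\<mu> n) {a<..b})"
    by blast
qed (rule \<mu>)

text \<open>The transforms at \<open>1\<close> and \<open>-1\<close> give tightness, hence a weakly convergent subsequence.
Weak convergence only handles bounded test functions, so \<open>e\<^sup>s\<^sup>x\<close> is truncated at height \<open>N\<close>; since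
\<open>y - min y N \<le> y\<^sup>2 / N\<close>, the truncation error is at most the transform at \<open>2 s\<close> divided by \<open>N\<close>,
uniformly along the sequence. This is why convergence is required on the whole line.\<close>

lemma convergent_mgf_imp_mgf:
  fixes \<mu> :: "nat \<Rightarrow> real measure"
  assumes \<mu>: "\<And>n. real_distribution (\<mu> n)"
    and int: "\<And>n s. integrable (\<mu> n) (\<lambda>x. exp (s * x))"
    and lim: "\<And>s. (\<lambda>n. \<integral>x. exp (s * x) \<partial>\<mu> n) \<longlonglongrightarrow> \<phi> s"
  obtains M where "real_distribution M"
    "\<And>s. integrable M (\<lambda>x. exp (s * x))" "\<And>s. (\<integral>x. exp (s * x) \<partial>M) = \<phi> s"
proof -
  obtain r M where r: "strict_mono (r :: nat \<Rightarrow> nat)" and M: "real_distribution M"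
    and wc: "weak_conv_m (\<mu> \<circ> r) M"
    using tight_imp_convergent_subsubsequence[OF tight_of_convergent_mgf[OF assms] strict_mono_id]
    by auto
  note MD = real_distributionD[OF M]
  note [simp, measurable_cong] = MD(3)
  have trunc: "norm ((\<integral>x. min (exp (s * x)) N \<partial>M) - \<phi> s) \<le> \<phi> (2 * s) / N" if N: "0 < N" for s N :: real
  proof (rule LIMSEQ_le)
    let ?g = "\<lambda>x. min (exp (s * x)) N"
    have "(\<lambda>n. \<integral>x. ?g x \<partial>(\<mu> \<circ> r) n) \<longlonglongrightarrow> (\<integral>x. ?g x \<partial>M)"
    proof (rule weak_conv_imp_integral_bdd_continuous_conv[OF _ M wc, where B = N])
      show "isCont ?g x" for x by (intro continuous_intros)
      show "norm (?g x) \<le> N" for x using N by (auto simp: min_def)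
    qed (use \<mu> in auto)
    then show "(\<lambda>n. norm ((\<integral>x. ?g x \<partial>\<mu> (r n)) - (\<integral>x. exp (s * x) \<partial>\<mu> (r n))))
        \<longlonglongrightarrow> norm ((\<integral>x. ?g x \<partial>M) - \<phi> s)"
      using LIMSEQ_subseq_LIMSEQ[OF lim[of s] r] by (intro tendsto_norm tendsto_diff) (auto simp: o_def)
    show "(\<lambda>n. (\<integral>x. exp (2 * s * x) \<partial>\<mu> (r n)) / N) \<longlonglongrightarrow> \<phi> (2 * s) / N"
      using LIMSEQ_subseq_LIMSEQ[OF lim[of "2 * s"] r] N by (intro tendsto_divide) (auto simp: o_def)
    have "norm ((\<integral>x. ?g x \<partial>\<mu> n) - (\<integral>x. exp (s * x) \<partial>\<mu> n)) \<le> (\<integral>x. exp (2 * s * x) \<partial>\<mu> n) / N" for n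
    proof -
      note nD = real_distributionD[OF \<mu>[of n]]
      note [simp, measurable_cong] = nD(3)
      have g: "integrable (\<mu> n) ?g"
        by (rule finite_measure.integrable_const_bound[OF nD(2), of _ N]) (use N in \<open>auto simp: min_def\<close>)
      \<comment> \<open>Pointwise \<open>y - min y N \<le> y\<^sup>2 / N\<close> with \<open>y = e\<^sup>s\<^sup>x\<close>: where \<open>y > N\<close>, both factors of
        \<open>(y - N) N\<close> are at most \<open>y\<close>.\<close>
      have *: "norm (?g x - exp (s * x)) \<le> exp (2 * s * x) / N" for x
      proof (cases "exp (s * x) \<le> N")
        case False
        then have "(exp (s * x) - N) * N \<le> exp (s * x) * exp (s * x)"
          using N by (intro mult_mono) auto
        also have "\<dots> = exp (2 * s * x)" by (simp flip: exp_add add: algebra_simps)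
        finally show ?thesis using False N by (simp add: field_simps)
      qed (use N in simp)
      have "norm ((\<integral>x. ?g x \<partial>\<mu> n) - (\<integral>x. exp (s * x) \<partial>\<mu> n)) = norm (\<integral>x. ?g x - exp (s * x) \<partial>\<mu> n)"
        using g int by simp
      also have "\<dots> \<le> (\<integral>x. exp (2 * s * x) / N \<partial>\<mu> n)"
        using * g int by (intro order_trans[OF integral_norm_bound integral_mono]) auto
      finally show ?thesis by simp
    qed
    then show "\<exists>k. \<forall>n\<ge>k. norm ((\<integral>x. ?g x \<partial>\<mu> (r n)) - (\<integral>x. exp (s * x) \<partial>\<mu> (r n)))
        \<le> (\<integral>x. exp (2 * s * x) \<partial>\<mu> (r n)) / N"
      by blast
  qed
  have "integrable M (\<lambda>x. exp (s * x)) \<and> (\<integral>x. exp (s * x) \<partial>M) = \<phi> s" for s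
  proof -
    define g where "g N x = min (exp (s * x)) (real (Suc N))" for N x
    have int_g: "integrable M (g N)" for N
      unfolding g_def by (rule finite_measure.integrable_const_bound[OF MD(2), of _ "real (Suc N)"]) (auto simp: min_def)
    have "(\<lambda>N. \<integral>x. g N x \<partial>M) \<longlonglongrightarrow> \<phi> s"
    proof (rule Lim_transform2[OF tendsto_const])
      have "(\<lambda>N. (\<integral>x. g N x \<partial>M) - \<phi> s) \<longlonglongrightarrow> 0"
      proof (rule Lim_null_comparison)
        show "\<forall>\<^sub>F N in sequentially. norm ((\<integral>x. g N x \<partial>M) - \<phi> s) \<le> \<phi> (2 * s) / real (Suc N)"
          unfolding g_def using trunc[of "real (Suc _)" s] by (intro always_eventually) simp
        show "(\<lambda>N. \<phi> (2 * s) / real (Suc N)) \<longlonglongrightarrow> 0"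
          by (rule LIMSEQ_Suc[OF lim_const_over_n])
      qed
      then show "(\<lambda>N. \<phi> s - (\<integral>x. g N x \<partial>M)) \<longlonglongrightarrow> 0"
        using tendsto_minus by fastforce
    qed
    \<comment> \<open>The truncations increase to \<open>e\<^sup>s\<^sup>x\<close>, so both integrability and the value of the
      limit integral follow from monotone convergence.\<close>
    moreover have "AE x in M. mono (\<lambda>N. g N x)"
      by (auto simp: mono_def g_def min_def)
    moreover have "AE x in M. (\<lambda>N. g N x) \<longlonglongrightarrow> exp (s * x)"
    proof (rule AE_I2)
      fix x :: real
      obtain N0 :: nat where N0: "exp (s * x) \<le> N0" using real_arch_simple by blast
      have "\<forall>\<^sub>F N in sequentially. g N x = exp (s * x)"
        using N0 by (auto simp: g_def intro!: eventually_sequentiallyI[of N0])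
      then show "(\<lambda>N. g N x) \<longlonglongrightarrow> exp (s * x)" by (rule tendsto_eventually)
    qed
    ultimately have "has_bochner_integral M (\<lambda>x. exp (s * x)) (\<phi> s)"
      using int_g by (intro has_bochner_integral_monotone_convergence) auto
    then show ?thesis by (simp add: has_bochner_integral_iff)
  qed
  then show ?thesis using that M by blast
qed

section \<open>Bernstein's theorem on the whole line\<close>

text \<open>The upper bound comes from \<open>e\<^sup>x \<le> 1 / (1 - x)\<close>, which gives \<open>e\<^sup>x - 1 - x \<le> x\<^sup>2 / (1 - x)\<close>.\<close>

lemma exp_quadratic_remainder:
  fixes x :: real
  assumes "\<bar>x\<bar> \<le> 1 / 2"
  shows "\<bar>exp x - 1 - x\<bar> \<le> 2 * x\<^sup>2"
proof -
  have "(1 - x) * exp x \<le> 1"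
    using mult_right_mono[OF exp_ge_add_one_self[of "- x"], of "exp x"] by (simp flip: exp_add)
  then have "(1 - x) * (exp x - 1 - x) \<le> x\<^sup>2"
    by (simp add: algebra_simps power2_eq_square)
  moreover have "1 / 2 * (exp x - 1 - x) \<le> (1 - x) * (exp x - 1 - x)"
  proof (rule mult_right_mono)
    show "1 / 2 \<le> 1 - x" using assms by linarith
    show "0 \<le> exp x - 1 - x" using exp_ge_add_one_self[of x] by linarith
  qed
  ultimately have "exp x - 1 - x \<le> 2 * x\<^sup>2" by simp
  then show ?thesis using exp_ge_add_one_self[of x] by linarith
qed

lemma tendsto_exp_increment: "(\<lambda>n. - real n + real n * exp (s / real n)) \<longlonglongrightarrow> s"
proof -
  have "(\<lambda>n. (- real n + real n * exp (s / real n)) - s) \<longlonglongrightarrow> 0"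
  proof (rule Lim_null_comparison)
    obtain N :: nat where N: "2 * \<bar>s\<bar> < N" using reals_Archimedean2 by blast
    show "\<forall>\<^sub>F n in sequentially. norm ((- real n + real n * exp (s / real n)) - s) \<le> 2 * s\<^sup>2 / real n"
    proof (rule eventually_sequentiallyI[of "Suc N"])
      fix n assume n: "Suc N \<le> n"
      then have "\<bar>s / n\<bar> \<le> 1 / 2" using N by (simp add: field_simps)
      then have "n * \<bar>exp (s / n) - 1 - s / n\<bar> \<le> n * (2 * (s / n)\<^sup>2)"
        by (intro mult_left_mono exp_quadratic_remainder) auto
      moreover have "n * (2 * (s / n)\<^sup>2) = 2 * s\<^sup>2 / n"
        using n by (simp add: power2_eq_square)
      moreover have "n * \<bar>exp (s / n) - 1 - s / n\<bar> = \<bar>n * (exp (s / n) - 1 - s / n)\<bar>"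
        by (simp add: abs_mult)
      moreover have "n * (exp (s / n) - 1 - s / n) = (- real n + real n * exp (s / real n)) - s"
        using n by (simp add: algebra_simps)
      ultimately show "norm ((- real n + real n * exp (s / real n)) - s) \<le> 2 * s\<^sup>2 / real n"
        by simp
    qed
    show "(\<lambda>n. 2 * s\<^sup>2 / real n) \<longlonglongrightarrow> 0" by (rule lim_const_over_n)
  qed
  then show ?thesis by (rule Lim_transform2[OF tendsto_const, rotated] LIM_zero_cancel)
qed

text \<open>The Taylor series of \<open>f\<close> at \<open>-n\<close>, evaluated at \<open>-n + n e\<^sup>s\<^sup>/\<^sup>n\<close>, is
\<open>\<Sum>k. f\<^sup>(\<^sup>k\<^sup>)(-n) n\<^sup>k / k! \<cdot> e\<^sup>s\<^sup>k\<^sup>/\<^sup>n\<close>, which is the Laplace transform of the measure with these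
nonnegative weights at the points \<open>k / n\<close>. Dividing by \<open>f 0\<close> makes it a probability measure.\<close>

definition Taylor_measure :: "(real \<Rightarrow> real) \<Rightarrow> nat \<Rightarrow> real measure" where
  "Taylor_measure f n =
     distr (density (count_space UNIV)
         (\<lambda>k. ennreal ((deriv ^^ k) f (- real n) / fact k * real n ^ k / f 0)))
       borel (\<lambda>k. real k / real n)"

lemma Taylor_measure_mgf:
  assumes f: "strictly_absolutely_monotonic f" and n: "0 < n"
  shows "real_distribution (Taylor_measure f n)"
    and "integrable (Taylor_measure f n) (\<lambda>x. exp (s * x))"
    and "(\<integral>x. exp (s * x) \<partial>Taylor_measure f n) = f (- real n + real n * exp (s / real n)) / f 0"
proof -
  define w where "w k = (deriv ^^ k) f (- real n) / fact k * real n ^ k / f 0" for k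
  have pos: "0 < (deriv ^^ k) f s" for k s
    using f by (simp add: strictly_absolutely_monotonic_def)
  have f0: "0 < f 0" using pos[of 0 0] by simp
  have w: "0 \<le> w k" for k
    unfolding w_def using pos[of k "- real n"] f0
    by (intro divide_nonneg_nonneg mult_nonneg_nonneg) auto
  have sums: "(\<lambda>k. w k * exp (s * (real k / real n))) sums (f (- real n + real n * exp (s / real n)) / f 0)" for s
  proof -
    have "(\<lambda>k. (deriv ^^ k) f (- real n) / fact k * (real n * exp (s / real n)) ^ k / f 0)
        sums (f (- real n + real n * exp (s / real n)) / f 0)"
      by (intro sums_divide strictly_absolutely_monotonic_Taylor_sums[OF f]) simp
    moreover have "(deriv ^^ k) f (- real n) / fact k * (real n * exp (s / real n)) ^ k / f 0
        = w k * exp (s * (real k / real n))" for k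
      unfolding w_def by (simp add: exp_of_nat_mult[symmetric] algebra_simps)
    ultimately show ?thesis by simp
  qed
  have int: "integrable (count_space UNIV) (\<lambda>k. w k * exp (s * (real k / real n)))" for s
    using sums[of s] w by (auto simp: integrable_count_space_nat_iff abs_mult sums_iff)
  note lint = integral_count_space_nat[OF int]
  have M: "Taylor_measure f n = distr (density (count_space UNIV) (\<lambda>k. ennreal (w k))) borel (\<lambda>k. real k / real n)"
    unfolding Taylor_measure_def w_def ..
  show "integrable (Taylor_measure f n) (\<lambda>x. exp (s * x))"
    unfolding M using w int by (subst integrable_distr_eq) (auto simp: integrable_density)
  show "(\<integral>x. exp (s * x) \<partial>Taylor_measure f n) = f (- real n + real n * exp (s / real n)) / f 0"
    unfolding M using w sums[of s] lint[of s] by (subst integral_distr) (auto simp: integral_density sums_iff)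
  have "emeasure (density (count_space UNIV) (\<lambda>k. ennreal (w k))) UNIV = 1"
  proof -
    have "(\<integral>\<^sup>+k. ennreal (w k) \<partial>count_space UNIV) = ennreal (\<integral>k. w k \<partial>count_space UNIV)"
      using int[of 0] w by (intro nn_integral_eq_integral) auto
    also have "\<dots> = 1" using lint[of 0] sums[of 0] f0 by (simp add: sums_iff)
    finally show ?thesis by (simp add: emeasure_density)
  qed
  then have "prob_space (density (count_space UNIV) (\<lambda>k. ennreal (w k)))"
    by (intro prob_spaceI) simp
  then have "prob_space (Taylor_measure f n)"
    unfolding M by (rule prob_space.prob_space_distr) simp
  then show "real_distribution (Taylor_measure f n)"
    unfolding real_distribution_def real_distribution_axioms_def by (simp add: M)
qed

text \<open>Bernstein's theorem for functions that are absolutely monotonic on the whole line. The measures above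
have the transforms \<open>f (- n + n e\<^sup>s\<^sup>/\<^sup>n) / f 0\<close>, which converge to \<open>f s / f 0\<close> because
\<open>n (e\<^sup>s\<^sup>/\<^sup>n - 1)\<close> tends to \<open>s\<close> and \<open>f\<close> is continuous.\<close>

theorem Bernstein_whole_line:
  assumes f: "strictly_absolutely_monotonic f"
  obtains M where "real_distribution M" "\<And>s. integrable M (\<lambda>x. exp (s * x))"
    "\<And>s. (\<integral>x. exp (s * x) \<partial>M) = f s / f 0"
proof (rule convergent_mgf_imp_mgf)
  show "real_distribution (Taylor_measure f (Suc n))" for n
    by (rule Taylor_measure_mgf(1)[OF f]) simp
  show "integrable (Taylor_measure f (Suc n)) (\<lambda>x. exp (s * x))" for n s
    by (rule Taylor_measure_mgf(2)[OF f]) simp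
  show "(\<lambda>n. \<integral>x. exp (s * x) \<partial>Taylor_measure f (Suc n)) \<longlonglongrightarrow> f s / f 0" for s
  proof -
    have "isCont f s"
      using strictly_absolutely_monotonic_DERIV[OF f, of 0 s] by (auto intro: DERIV_isCont)
    then have "(\<lambda>n. f (- real (Suc n) + real (Suc n) * exp (s / real (Suc n)))) \<longlonglongrightarrow> f s"
      by (rule isCont_tendsto_compose) (rule LIMSEQ_Suc[OF tendsto_exp_increment])
    then have "(\<lambda>n. f (- real (Suc n) + real (Suc n) * exp (s / real (Suc n))) / f 0) \<longlonglongrightarrow> f s / f 0"
      using f[unfolded strictly_absolutely_monotonic_def, rule_format, of 0 0] by (intro tendsto_divide) auto
    then show ?thesis by (subst Taylor_measure_mgf(3)[OF f]) simp_all
  qed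
qed (use that in blast)

section \<open>Growth of the transform and support of the measure\<close>

text \<open>The rate of exponential growth of the transform bounds the support: mass \<open>m\<close> on \<open>r x \<ge> c + \<epsilon>\<close>
contributes \<open>m e\<^sup>s\<^sup>(\<^sup>c\<^sup>+\<^sup>\<epsilon>\<^sup>)\<close>, which outgrows \<open>C e\<^sup>s\<^sup>c\<close> unless \<open>m = 0\<close>. The function \<open>r\<close> is a
parameter so that the lemma also gives lower bounds of the support, through \<open>r x = - x\<close>.\<close>

lemma mgf_growth_imp_AE_le:
  fixes r :: "'a \<Rightarrow> real"
  assumes "finite_measure M" and r[measurable]: "r \<in> borel_measurable M"
    and int: "\<And>s. 0 \<le> s \<Longrightarrow> integrable M (\<lambda>x. exp (s * r x))"
    and le: "\<And>s. 0 \<le> s \<Longrightarrow> (\<integral>x. exp (s * r x) \<partial>M) \<le> C * exp (s * c)"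
  shows "AE x in M. r x \<le> c"
proof -
  note emeasure_eq_measure = finite_measure.emeasure_eq_measure[OF \<open>finite_measure M\<close>]
  have C: "0 \<le> C" using le[of 0] by simp (metis measure_nonneg order_trans)
  have "AE x in M. r x < c + \<epsilon>" if \<epsilon>: "0 < \<epsilon>" for \<epsilon>
  proof -
    define A where "A = {x \<in> space M. c + \<epsilon> \<le> r x}"
    have A[measurable]: "A \<in> sets M" unfolding A_def by measurable
    have markov: "measure M A * exp (s * \<epsilon>) \<le> C" if s: "0 \<le> s" for s
    proof -
      have "(\<integral>x. exp (s * (c + \<epsilon>)) * indicator A x \<partial>M) \<le> (\<integral>x. exp (s * r x) \<partial>M)"
        using s by (intro integral_mono int integrable_mult_right)
          (auto simp: A_def emeasure_eq_measure mult_left_mono split: split_indicator)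
      also have "\<dots> \<le> C * exp (s * c)" by (rule le[OF s])
      finally have "(exp (s * \<epsilon>) * measure M A) * exp (s * c) \<le> C * exp (s * c)"
        using A by (simp add: exp_add algebra_simps)
      then show ?thesis by (simp add: mult.commute)
    qed
    have "measure M A = 0"
    proof (rule ccontr)
      assume "measure M A \<noteq> 0"
      then have m: "0 < measure M A" by (simp add: zero_less_measure_iff)
      \<comment> \<open>With \<open>m = measure M A\<close>, the choice \<open>s = C / (m \<epsilon>)\<close> in the Markov bound gives
        \<open>m e\<^sup>C\<^sup>/\<^sup>m \<le> C\<close>, against \<open>m (1 + C / m) = m + C\<close>.\<close>
      have "measure M A * (1 + C / measure M A) \<le> measure M A * exp (C / measure M A)"
        by (intro mult_left_mono exp_ge_add_one_self) simp
      also have "\<dots> \<le> C"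
        using markov[of "C / measure M A / \<epsilon>"] C m \<epsilon> by simp
      finally have "measure M A + C \<le> C" using m by (simp add: distrib_left)
      with m show False by simp
    qed
    then have "AE x in M. x \<notin> A"
      using A by (simp add: AE_iff_measurable[of A] emeasure_eq_measure A_def)
    then show ?thesis by (auto simp: A_def)
  qed
  then have "AE x in M. \<forall>n. r x < c + 1 / real (Suc n)"
    unfolding AE_all_countable by simp
  then show ?thesis
  proof eventually_elim
    case (elim x)
    have "(\<lambda>n. c + 1 / real (Suc n)) \<longlonglongrightarrow> c + 0"
      by (intro tendsto_intros LIMSEQ_Suc[OF lim_const_over_n])
    with elim show ?case
      by (intro LIMSEQ_le_const[of _ "c"]) (auto intro: less_imp_le)
  qed
qed

section \<open>Absolute monotonicity of Laplace transforms\<close>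

lemma integrable_moment_exp:
  fixes r :: "'a \<Rightarrow> real"
  assumes M: "finite_measure M" and r[measurable]: "r \<in> borel_measurable M"
    and r01: "\<And>x. x \<in> space M \<Longrightarrow> 0 \<le> r x \<and> r x \<le> 1"
  shows "integrable M (\<lambda>x. r x ^ k * exp (s * r x))"
proof (rule finite_measure.integrable_const_bound[OF M])
  show "AE x in M. norm (r x ^ k * exp (s * r x)) \<le> 1 * exp \<bar>s\<bar>"
  proof (rule AE_I2)
    fix x assume x: "x \<in> space M"
    have "s * r x \<le> \<bar>s\<bar> * 1" using r01[OF x] by (intro mult_mono) auto
    then show "norm (r x ^ k * exp (s * r x)) \<le> 1 * exp \<bar>s\<bar>"
      unfolding norm_mult using r01[OF x] by (intro mult_mono) (auto simp: power_le_one)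
  qed
qed auto

text \<open>Differentiation under the integral sign. As \<open>r\<close> takes values in \<open>[0,1]\<close>, the quadratic remainder
bound for the exponential holds uniformly in the integration variable, so the difference quotient is
within \<open>O(h)\<close> of its limit.\<close>

lemma DERIV_moment_integral:
  fixes r :: "'a \<Rightarrow> real"
  assumes M: "finite_measure M" and r[measurable]: "r \<in> borel_measurable M"
    and r01: "\<And>x. x \<in> space M \<Longrightarrow> 0 \<le> r x \<and> r x \<le> 1"
  shows "((\<lambda>s. \<integral>x. r x ^ k * exp (s * r x) \<partial>M) has_real_derivative (\<integral>x. r x ^ Suc k * exp (s * r x) \<partial>M)) (at s)"
proof -
  note int = integrable_moment_exp[OF M r r01]
  define G where "G k s = (\<integral>x. r x ^ k * exp (s * r x) \<partial>M)" for k s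
  have "(\<lambda>h. (G k (s + h) - G k s) / h - G (Suc k) s) \<midarrow>0\<rightarrow> 0"
  proof (rule Lim_null_comparison)
    show "\<forall>\<^sub>F h in at 0. norm ((G k (s + h) - G k s) / h - G (Suc k) s) \<le> 2 * G 0 s * \<bar>h\<bar>"
      unfolding eventually_at
    proof (intro exI[of _ "1 / 2"] conjI ballI impI)
      fix h :: real assume "h \<noteq> 0 \<and> dist h 0 < 1 / 2"
      then have h: "h \<noteq> 0" "\<bar>h\<bar> \<le> 1 / 2" by (auto simp: dist_real_def)
      have pt: "\<bar>r x ^ k * exp ((s + h) * r x) - r x ^ k * exp (s * r x) - h * (r x ^ Suc k * exp (s * r x))\<bar>
          \<le> 2 * h\<^sup>2 * (r x ^ 0 * exp (s * r x))" if x: "x \<in> space M" for x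
      proof -
        have "\<bar>h * r x\<bar> \<le> \<bar>h\<bar> * 1" unfolding abs_mult using r01[OF x] by (intro mult_left_mono) auto
        then have hr: "\<bar>h * r x\<bar> \<le> \<bar>h\<bar>" by simp
        then have "\<bar>exp (h * r x) - 1 - h * r x\<bar> \<le> 2 * (h * r x)\<^sup>2"
          using h by (intro exp_quadratic_remainder) auto
        also have "\<dots> \<le> 2 * h\<^sup>2" using hr by (simp add: abs_le_square_iff)
        finally have "(r x ^ k * exp (s * r x)) * \<bar>exp (h * r x) - 1 - h * r x\<bar> \<le> (1 * exp (s * r x)) * (2 * h\<^sup>2)"
          using r01[OF x] by (intro mult_mono) (auto simp: power_le_one)
        moreover have "r x ^ k * exp ((s + h) * r x) - r x ^ k * exp (s * r x) - h * (r x ^ Suc k * exp (s * r x))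
            = (r x ^ k * exp (s * r x)) * (exp (h * r x) - 1 - h * r x)"
          by (simp add: exp_add algebra_simps)
        ultimately show ?thesis using r01[OF x] by (simp add: abs_mult)
      qed
      have "\<bar>G k (s + h) - G k s - h * G (Suc k) s\<bar>
          = \<bar>\<integral>x. r x ^ k * exp ((s + h) * r x) - r x ^ k * exp (s * r x) - h * (r x ^ Suc k * exp (s * r x)) \<partial>M\<bar>"
        unfolding G_def using int[of k] int[of "Suc k" s] by (simp del: power_Suc)
      also have "\<dots> \<le> (\<integral>x. 2 * h\<^sup>2 * (r x ^ 0 * exp (s * r x)) \<partial>M)"
        using pt int[of k] int[of "Suc k" s] int[of 0 s]
        by (intro order_trans[OF integral_abs_bound integral_mono]) (auto simp del: power_Suc)
      also have "\<dots> = 2 * h\<^sup>2 * G 0 s"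
        unfolding G_def by simp
      finally have "\<bar>G k (s + h) - G k s - h * G (Suc k) s\<bar> / \<bar>h\<bar> \<le> 2 * h\<^sup>2 * G 0 s / \<bar>h\<bar>"
        by (rule divide_right_mono) simp
      moreover have "2 * h\<^sup>2 * G 0 s / \<bar>h\<bar> = 2 * G 0 s * \<bar>h\<bar>"
        using h by (auto simp: power2_eq_square abs_if field_simps)
      moreover have "\<bar>G k (s + h) - G k s - h * G (Suc k) s\<bar> / \<bar>h\<bar> = \<bar>(G k (s + h) - G k s) / h - G (Suc k) s\<bar>"
        using h by (simp add: abs_divide[symmetric] diff_divide_distrib)
      ultimately show "norm ((G k (s + h) - G k s) / h - G (Suc k) s) \<le> 2 * G 0 s * \<bar>h\<bar>" by simp
    qed simp
    show "((\<lambda>h. 2 * G 0 s * \<bar>h\<bar>) \<longlongrightarrow> 0) (at 0)" by (auto intro!: tendsto_eq_intros)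
  qed
  then show ?thesis
    unfolding DERIV_def G_def[symmetric] by (rule LIM_zero_cancel)
qed

lemma strictly_absolutely_monotonic_integral:
  fixes r :: "'a \<Rightarrow> real"
  assumes M: "finite_measure M" and r[measurable]: "r \<in> borel_measurable M"
    and r01: "\<And>x. x \<in> space M \<Longrightarrow> 0 \<le> r x \<and> r x \<le> 1"
    and pos: "AE x in M. 0 < r x" and nz: "emeasure M (space M) \<noteq> 0"
  shows "strictly_absolutely_monotonic (\<lambda>s. \<integral>x. exp (s * r x) \<partial>M)"
proof -
  let ?G = "\<lambda>k s. \<integral>x. r x ^ k * exp (s * r x) \<partial>M"
  note D = DERIV_moment_integral[OF M r r01]
  have deriv: "(deriv ^^ k) (\<lambda>s. \<integral>x. exp (s * r x) \<partial>M) = ?G k" for k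
  proof (induction k)
    case (Suc k)
    then show ?case using D[of k] by (auto intro!: DERIV_imp_deriv simp del: power_Suc)
  qed simp
  have "0 < ?G k s" for k s
  proof -
    note int = integrable_moment_exp[OF M r r01, of k s]
    have "0 \<le> ?G k s" using r01 by (intro integral_nonneg_AE) auto
    moreover have "?G k s \<noteq> 0"
    proof
      assume "?G k s = 0"
      then have "AE x in M. r x ^ k * exp (s * r x) = 0"
        using integral_nonneg_eq_0_iff_AE[OF int] r01 by auto
      with pos have "AE x in M. False" by eventually_elim auto
      then show False using nz by (simp add: AE_iff_null null_setsD1)
    qed
    ultimately show ?thesis by simp
  qed
  moreover have "?G k differentiable at s" for k s
    using D[of k s] unfolding real_differentiable_def by blast
  ultimately show ?thesis
    unfolding strictly_absolutely_monotonic_def deriv by blast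
qed

section \<open>Representation of the class of absolutely monotonic functions with exponential bounds\<close>

lemma exp_div_inverse:
  assumes "0 \<le> x"
  shows "exp_div s (inverse (ereal x)) = exp (s * x)"
  using assms by (cases "x = 0") (auto simp: exp_div_def divide_inverse)

text \<open>Bernstein's theorem gives a measure in the variable \<open>x = 1 / p\<close>. The upper bound for \<open>s \<ge> 0\<close>
confines it to \<open>x \<le> 1 / a\<close>, the one for \<open>s \<le> 0\<close> to \<open>x \<ge> 1 / b\<close>, and the image under \<open>x \<mapsto> 1 / x\<close> is the required
measure. In the extended reals \<open>1 / 0 = \<infinity>\<close>, so mass at \<open>x = 0\<close>, which can occur only for \<open>b = \<infinity>\<close>,
is sent to \<open>p = \<infinity>\<close>.\<close>

theorem AM_representation:
  fixes a b :: ereal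
  assumes a: "1 \<le> a" and ab: "a < b" and \<zeta>: "\<zeta> \<in> AM a b"
  obtains \<nu> where "borel_measure_on {a..b} \<nu>" "finite_measure \<nu>"
    "\<And>s. integrable \<nu> (exp_div s)" "\<And>s. \<zeta> s = (\<integral>p. exp_div s p \<partial>\<nu>)"
proof -
  have am: "strictly_absolutely_monotonic \<zeta>" and eb: "exponential_bounds a b \<zeta>"
    using \<zeta> by (auto simp: AM_def)
  have \<zeta>0: "0 < \<zeta> 0"
    using am[unfolded strictly_absolutely_monotonic_def, rule_format, of 0 0] by simp
  obtain M where M: "real_distribution M" and int: "\<And>s. integrable M (\<lambda>x. exp (s * x))"
    and mgf: "\<And>s. (\<integral>x. exp (s * x) \<partial>M) = \<zeta> s / \<zeta> 0"
    using Bernstein_whole_line[OF am] by metis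
  note MD = real_distributionD[OF M]
  note [simp, measurable_cong] = MD(3)
  obtain C where C: "\<And>s. 0 \<le> s \<Longrightarrow> \<zeta> s \<le> C * exp_div s a" "\<And>s. s \<le> 0 \<Longrightarrow> \<zeta> s \<le> C * exp_div s b"
    using eb unfolding exponential_bounds_def by blast
  define u where "u = real_of_ereal (1 / a)"
  define t where "t = real_of_ereal (1 / b)"
  have b1: "1 \<le> b" using a ab by simp
  have inv: "inverse (ereal u) = a" "inverse (ereal t) = b" "0 < u" "0 \<le> t"
    using a ab b1 unfolding u_def t_def
    by (cases a; cases b; auto simp: one_ereal_def field_simps divide_ereal_def)+
  have AE_u: "AE x in M. x \<le> u"
  proof (rule mgf_growth_imp_AE_le)
    fix s :: real assume s: "0 \<le> s"
    show "(\<integral>x. exp (s * x) \<partial>M) \<le> C / \<zeta> 0 * exp (s * u)"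
      unfolding mgf using C(1)[OF s] \<zeta>0 exp_div_eq[OF a, of s] by (simp add: u_def field_simps)
  qed (use int MD(2) in auto)
  have AE_t: "AE x in M. - x \<le> - t"
  proof (rule mgf_growth_imp_AE_le)
    fix s :: real assume s: "0 \<le> s"
    show "(\<integral>x. exp (s * - x) \<partial>M) \<le> C / \<zeta> 0 * exp (s * - t)"
      using mgf[of "- s"] C(2)[of "- s"] s \<zeta>0 exp_div_eq[OF b1, of "- s"] by (simp add: t_def field_simps)
    show "integrable M (\<lambda>x. exp (s * - x))"
      using int[of "- s"] by simp
  qed (use MD(2) in auto)
  \<comment> \<open>Clamping to \<open>[a,b]\<close> changes \<open>1 / x\<close> only on a null set; it makes
     the map take all its values in the required space.\<close>
  define g where "g x = max a (min b (inverse (ereal x)))" for x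
  define N where "N = distr M (restrict_space borel {a..b}) g"
  define \<nu> where "\<nu> = density N (\<lambda>_. ennreal (\<zeta> 0))"
  have g[measurable]: "g \<in> M \<rightarrow>\<^sub>M restrict_space borel {a..b}"
    using ab unfolding g_def by (intro measurable_restrict_space2) auto
  have ed[measurable]: "exp_div s \<in> borel_measurable (restrict_space borel {a..b})" for s
    unfolding exp_div_def by (intro measurable_restrict_space1) measurable
  have eq: "AE x in M. exp_div s (g x) = exp (s * x)" for s
    using AE_u AE_t
  proof eventually_elim
    case (elim x)
    then have x: "0 \<le> x" "t \<le> x" "x \<le> u" using inv by auto
    have "a \<le> inverse (ereal x)"
      unfolding inv(1)[symmetric] using x by (intro ereal_inverse_antimono) auto
    moreover have "inverse (ereal x) \<le> b"
      unfolding inv(2)[symmetric] using x inv by (intro ereal_inverse_antimono) auto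
    ultimately have "g x = inverse (ereal x)" by (auto simp: g_def)
    then show ?case using exp_div_inverse[OF x(1)] by simp
  qed
  have iN: "integrable N (exp_div s)" "(\<integral>p. exp_div s p \<partial>N) = \<zeta> s / \<zeta> 0" for s
  proof -
    have [measurable]: "(\<lambda>x. exp_div s (g x)) \<in> borel_measurable M"
      by (rule measurable_compose[OF g ed])
    show "integrable N (exp_div s)"
      unfolding N_def using int[of s] integrable_cong_AE[OF _ _ eq[of s]]
      by (subst integrable_distr_eq[OF g ed]) simp
    show "(\<integral>p. exp_div s p \<partial>N) = \<zeta> s / \<zeta> 0"
      unfolding N_def mgf[symmetric] by (subst integral_distr[OF g ed]) (intro integral_cong_AE eq; measurable)
  qed
  have edN: "exp_div s \<in> borel_measurable N" for s using ed unfolding N_def by simp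
  show ?thesis
  proof
    show "borel_measure_on {a..b} \<nu>" by (simp add: borel_measure_on_def \<nu>_def N_def)
    have N: "prob_space N" unfolding N_def by (rule prob_space.prob_space_distr[OF MD(1) g])
    show "finite_measure \<nu>"
      unfolding \<nu>_def by (intro finite_measureI) (simp add: emeasure_density prob_space.emeasure_space_1[OF N])
    show "integrable \<nu> (exp_div s)" for s
      unfolding \<nu>_def using iN edN \<zeta>0 by (subst integrable_density) auto
    show "\<zeta> s = (\<integral>p. exp_div s p \<partial>\<nu>)" for s
      unfolding \<nu>_def using iN[of s] edN \<zeta>0 by (subst integral_density) auto
  qed
qed

section \<open>Norms of indicators and the fundamental function\<close>

lemma epowr_ennreal: "0 \<le> x \<Longrightarrow> epowr (ennreal x) r = ennreal (x powr r)"
  by (simp add: epowr_def)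

lemma esssup_indicator:
  assumes [measurable]: "A \<in> sets M" and "emeasure M A \<noteq> 0"
  shows "esssup M (\<lambda>x. ennreal \<bar>indicat_real A x\<bar>) = 1"
proof (rule antisym)
  show "esssup M (\<lambda>x. ennreal \<bar>indicat_real A x\<bar>) \<le> 1"
    by (intro esssup_I) (auto split: split_indicator)
  show "1 \<le> esssup M (\<lambda>x. ennreal \<bar>indicat_real A x\<bar>)"
  proof (rule ccontr)
    assume c: "\<not> ?thesis"
    have "AE x in M. ennreal \<bar>indicat_real A x\<bar> \<le> esssup M (\<lambda>x. ennreal \<bar>indicat_real A x\<bar>)"
      by (rule esssup_AE)
    then have "AE x in M. x \<notin> A"
    proof eventually_elim
      case (elim x)
      then show ?case using c by (cases "x \<in> A") auto
    qed
    then have "A \<in> null_sets M" by (rule AE_iff_null_sets[OF assms(1), THEN iffD2])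
    then show False using assms(2) by (simp add: null_setsD1)
  qed
qed

lemma Lp_norm_indicator:
  assumes [measurable]: "A \<in> sets M" and A: "emeasure M A = ennreal \<delta>" and \<delta>: "0 < \<delta>" and p: "1 \<le> p"
  shows "Lp_norm M p (indicat_real A) = ennreal (\<delta> powr real_of_ereal (1 / p))"
proof (cases "p = \<infinity>")
  case True
  then show ?thesis using esssup_indicator[of A M] A \<delta> by (simp add: Lp_norm_def)
next
  case False
  then obtain q where q: "p = ereal q" "1 \<le> q" using p by (cases p) (auto simp: one_ereal_def)
  have "(\<integral>\<^sup>+x. ennreal (\<bar>indicat_real A x\<bar> powr q) \<partial>M) = (\<integral>\<^sup>+x. indicator A x \<partial>M)"
    by (intro nn_integral_cong) (auto split: split_indicator)
  also have "\<dots> = ennreal \<delta>" using A by simp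
  finally show ?thesis
    using q \<delta> by (simp add: Lp_norm_def epowr_ennreal one_ereal_def)
qed

text \<open>Sets of measure \<open>2\<^sup>-\<^sup>n\<close> exist but need not be nested. Their tail unions are nested, and removing the
limes superior, which is null by the Borel-Cantelli lemma, makes the intersection empty without
changing the measures.\<close>

lemma decreasing_indicators:
  assumes M: "\<And>\<delta>. 0 < \<delta> \<Longrightarrow> \<exists>A\<in>sets M. emeasure M A = ennreal \<delta>"
  obtains B :: "nat \<Rightarrow> 'a set" where "\<And>n. B n \<in> sets M" "decseq B" "(\<Inter>n. B n) = {}"
    "\<And>n. 0 < emeasure M (B n)" "\<And>n. emeasure M (B n) < \<infinity>"
proof -
  have "\<exists>A\<in>sets M. emeasure M A = ennreal ((1 / 2) ^ n)" for n :: nat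
    by (rule M) simp
  then obtain A where A: "\<And>n. A n \<in> sets M" "\<And>n. emeasure M (A n) = ennreal ((1 / 2) ^ n)"
    by metis
  have mA: "measure M (A n) = (1 / 2) ^ n" for n
    using A(2)[of n] by (simp add: measure_def)
  have sm: "summable (\<lambda>n. (1 / 2 :: real) ^ n)" by (rule summable_geometric) simp
  have null: "limsup A \<in> null_sets M"
    using A sm by (intro borel_cantelli_limsup1) (auto simp: mA)
  define B where "B n = (\<Union>k\<in>{n..}. A k) - limsup A" for n
  have U: "(\<Union>k\<in>{n..}. A k) \<in> sets M" for n using A by auto
  have em: "emeasure M (B n) = emeasure M (\<Union>k\<in>{n..}. A k)" for n
    unfolding B_def using null U by (intro emeasure_Diff_null_set)
  show ?thesis
  proof
    show "B n \<in> sets M" for n unfolding B_def using U null by auto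
    show "decseq B" unfolding B_def decseq_def by (intro allI impI Diff_mono UN_mono) auto
    show "(\<Inter>n. B n) = {}" unfolding B_def limsup_INF_SUP by auto
    show "0 < emeasure M (B n)" for n
    proof -
      have "ennreal ((1 / 2) ^ n) \<le> emeasure M (\<Union>k\<in>{n..}. A k)"
        unfolding A(2)[symmetric] using U by (intro emeasure_mono) auto
      then show ?thesis unfolding em by (rule less_le_trans[rotated]) simp
    qed
    show "emeasure M (B n) < \<infinity>" for n
    proof -
      have "emeasure M (\<Union>k\<in>{n..}. A k) \<le> emeasure M (\<Union>k. A k)"
        using A by (intro emeasure_mono) auto
      also have "\<dots> \<le> (\<Sum>k. emeasure M (A k))"
        using A by (intro emeasure_subadditive_countably) auto
      also have "\<dots> = ennreal (\<Sum>k. (1 / 2) ^ k)"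
        unfolding A(2) using sm by (intro suminf_ennreal2) auto
      finally show ?thesis unfolding em by (rule le_less_trans) simp
    qed
  qed
qed

context
  fixes M :: "'t measure" and \<nu> :: "ereal measure" and Q :: real and a b :: ereal
  assumes igl: "integral_grand_lebesgue M \<nu> Q a b" and finite_nu: "emeasure \<nu> {a..b} < \<infinity>"
begin

lemma borel_nu: "sets \<nu> = sets (restrict_space borel {a..b})"
  using integral_grand_lebesgue.borel_nu[OF igl] by (simp add: borel_measure_on_def)

lemma endpoints: "1 \<le> a" "a < b"
  using integral_grand_lebesgue.a_ge_1[OF igl] integral_grand_lebesgue.a_less_b[OF igl] by auto

lemma Q_ge_1: "1 \<le> Q"
  by (rule integral_grand_lebesgue.Q_ge_1[OF igl])

lemma realizable: "0 < \<delta> \<Longrightarrow> \<exists>A\<in>sets M. emeasure M A = ennreal \<delta>"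
  by (rule integral_grand_lebesgue.realizable[OF igl])

lemma nu_nonzero: "emeasure \<nu> {a..b} \<noteq> 0"
  by (rule integral_grand_lebesgue.nu_nonzero[OF igl])

lemma space_nu: "space \<nu> = {a..b}"
  using sets_eq_imp_space_eq[OF borel_nu] by (simp add: space_restrict_space)

lemma finite_measure_nu: "finite_measure \<nu>"
  using finite_nu by (intro finite_measureI) (simp add: space_nu)

lemma emeasure_nu: "emeasure \<nu> A = ennreal (measure \<nu> A)"
  by (rule finite_measure.emeasure_eq_measure[OF finite_measure_nu])

lemma nu_ge_1: "p \<in> space \<nu> \<Longrightarrow> 1 \<le> p"
  using endpoints by (auto simp: space_nu)

lemma measurable_reciprocal: "(\<lambda>p. real_of_ereal (1 / p)) \<in> borel_measurable \<nu>"
proof -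
  have "(\<lambda>p. real_of_ereal (1 / p)) \<in> borel_measurable (restrict_space borel {a..b})"
    by (intro measurable_restrict_space1) measurable
  then show ?thesis
    using measurable_cong_sets[OF borel_nu refl] by blast
qed

lemma reciprocal_bounds: "p \<in> space \<nu> \<Longrightarrow> 0 \<le> real_of_ereal (1 / p) \<and> real_of_ereal (1 / p) \<le> 1"
  using nu_ge_1[of p] by (cases p) (auto simp: one_ereal_def)

lemma exp_div_nu: "p \<in> space \<nu> \<Longrightarrow> exp_div s p = exp (s * real_of_ereal (1 / p))"
  by (rule exp_div_eq[OF nu_ge_1])

lemma integrable_exp_div: "integrable \<nu> (exp_div s)"
  using integrable_moment_exp[OF finite_measure_nu measurable_reciprocal reciprocal_bounds, of 0 s]
  by (simp add: exp_div_nu cong: Bochner_Integration.integrable_cong)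

lemma exp_div_nonneg: "0 \<le> exp_div s p"
  by (simp add: exp_div_def)

lemma integral_exp_div_nonneg: "0 \<le> (\<integral>p. exp_div s p \<partial>\<nu>)"
  by (intro integral_nonneg_AE) (simp add: exp_div_nonneg)

lemma IGLS_norm_indicator:
  assumes A: "A \<in> sets M" "emeasure M A = ennreal \<delta>" and \<delta>: "0 < \<delta>"
  shows "IGLS_norm M \<nu> Q (indicat_real A) = ennreal ((\<integral>p. exp_div (Q * ln \<delta>) p \<partial>\<nu>) powr (1 / Q))"
proof -
  have "epowr (Lp_norm M p (indicat_real A)) Q = ennreal (exp_div (Q * ln \<delta>) p)" if p: "p \<in> space \<nu>" for p
    using Lp_norm_indicator[OF A \<delta> nu_ge_1[OF p]] exp_div_nu[OF p] \<delta>
    by (simp add: epowr_ennreal powr_powr) (simp add: powr_def mult_ac)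
  then have "(\<integral>\<^sup>+p. epowr (Lp_norm M p (indicat_real A)) Q \<partial>\<nu>) = (\<integral>\<^sup>+p. ennreal (exp_div (Q * ln \<delta>) p) \<partial>\<nu>)"
    by (rule nn_integral_cong)
  also have "\<dots> = ennreal (\<integral>p. exp_div (Q * ln \<delta>) p \<partial>\<nu>)"
    by (intro nn_integral_eq_integral integrable_exp_div) (simp add: exp_div_nonneg)
  finally show ?thesis
    by (simp add: IGLS_norm_def epowr_ennreal integral_exp_div_nonneg)
qed

text \<open>The norm of an indicator depends only on the measure of the set, and sets of every measure exist, so
the definite description in the fundamental function denotes.\<close>

lemma fundamental_function_eq:
  assumes \<delta>: "0 < \<delta>"
  shows "fundamental_function M \<nu> Q \<delta> = ennreal ((\<integral>p. exp_div (Q * ln \<delta>) p \<partial>\<nu>) powr (1 / Q))"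
  unfolding fundamental_function_def
proof (rule the_equality)
  show "\<exists>A\<in>sets M. emeasure M A = ennreal \<delta> \<and>
      ennreal ((\<integral>p. exp_div (Q * ln \<delta>) p \<partial>\<nu>) powr (1 / Q)) = IGLS_norm M \<nu> Q (indicat_real A)"
    using realizable[OF \<delta>] IGLS_norm_indicator[OF _ _ \<delta>] by metis
qed (use IGLS_norm_indicator[OF _ _ \<delta>] in auto)

lemma fundamental_function_powr:
  "epowr (fundamental_function M \<nu> Q (exp (s / Q))) Q = ennreal (\<integral>p. exp_div s p \<partial>\<nu>)"
  using Q_ge_1 integral_exp_div_nonneg[of s]
  by (simp add: fundamental_function_eq epowr_ennreal powr_powr)

lemma zeta_eq: "zeta M \<nu> Q s = (\<integral>p. exp_div s p \<partial>\<nu>)"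
  by (simp add: zeta_def fundamental_function_powr integral_exp_div_nonneg)

text \<open>Order continuity excludes an atom of \<open>\<nu>\<close> at \<open>\<infinity>\<close>: indicators of non-null sets decreasing to the
empty set have \<open>L\<^sub>\<infinity>\<close>-norm \<open>1\<close>, so such an atom would keep their norms away from \<open>0\<close>. Without this
fact \<open>\<zeta>\<close> could be constant, and its derivatives would not be positive.\<close>

lemma AE_finite_exponent: "AE p in \<nu>. p \<noteq> \<infinity>"
proof -
  obtain B where B: "\<And>n. B n \<in> sets M" "decseq B" "(\<Inter>n. B n) = {}"
    "\<And>n. 0 < emeasure M (B n)" "\<And>n. emeasure M (B n) < \<infinity>"
    using decreasing_indicators[OF realizable] by blast
  have d: "0 < measure M (B n)" "emeasure M (B n) = ennreal (measure M (B n))" for n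
  proof -
    show *: "emeasure M (B n) = ennreal (measure M (B n))"
      using B(5)[of n] by (intro emeasure_eq_ennreal_measure) auto
    show "0 < measure M (B n)"
      using B(4)[of n] unfolding * by simp
  qed
  define m where "m = measure \<nu> ({\<infinity>} \<inter> space \<nu>)"
  have S: "{\<infinity>} \<inter> space \<nu> \<in> sets \<nu>"
    unfolding space_nu borel_nu sets_restrict_space
    by (rule image_eqI[of _ _ "{\<infinity>}"]) (simp_all only: Int_commute borel_singleton sets.empty_sets)
  \<comment> \<open>At \<open>p = \<infinity>\<close> the integrand is \<open>e\<^sup>0 = 1\<close>, whatever \<open>s\<close> is.\<close>
  have low: "m \<le> (\<integral>p. exp_div s p \<partial>\<nu>)" for s
  proof -
    have "(\<integral>p. indicator ({\<infinity>} \<inter> space \<nu>) p \<partial>\<nu>) \<le> (\<integral>p. exp_div s p \<partial>\<nu>)"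
      using S by (intro integral_mono integrable_exp_div)
        (auto simp: emeasure_nu exp_div_nonneg exp_div_def split: split_indicator)
    then show ?thesis using S by (simp add: m_def)
  qed
  have "(\<lambda>n. IGLS_norm M \<nu> Q (indicat_real (B n))) \<longlonglongrightarrow> 0"
  proof (rule integral_grand_lebesgue.order_continuous[OF igl, unfolded order_continuous_norm_def, rule_format])
    show "indicat_real (B n) \<in> IGLS M \<nu> Q" for n
      using B(1)[of n] IGLS_norm_indicator[OF B(1) d(2) d(1), of n] by (simp add: IGLS_def)
    show "decseq (\<lambda>n. indicat_real (B n) x) \<and> (\<lambda>n. indicat_real (B n) x) \<longlonglongrightarrow> 0" for x
    proof
      show "decseq (\<lambda>n. indicat_real (B n) x)"
        using B(2) unfolding decseq_def by (auto split: split_indicator)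
      show "(\<lambda>n. indicat_real (B n) x) \<longlonglongrightarrow> 0"
        using LIMSEQ_indicator_decseq[OF B(2), where 'a = real, of x] B(3) by simp
    qed
  qed
  moreover have "ennreal (m powr (1 / Q)) \<le> IGLS_norm M \<nu> Q (indicat_real (B n))" for n
    unfolding IGLS_norm_indicator[OF B(1) d(2) d(1)] using low Q_ge_1
    by (intro ennreal_leI powr_mono2) (auto simp: m_def)
  ultimately have "ennreal (m powr (1 / Q)) \<le> 0"
    by (intro LIMSEQ_le_const) auto
  then have "m = 0" by (simp add: m_def)
  then have "{\<infinity>} \<inter> space \<nu> \<in> null_sets \<nu>"
    using S by (auto simp: m_def emeasure_nu)
  then have "AE p in \<nu>. p \<notin> {\<infinity>} \<inter> space \<nu>" by (rule AE_not_in)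
  then show ?thesis using AE_space by eventually_elim auto
qed

lemma strictly_absolutely_monotonic_zeta: "strictly_absolutely_monotonic (zeta M \<nu> Q)"
proof -
  have "strictly_absolutely_monotonic (\<lambda>s. \<integral>p. exp (s * real_of_ereal (1 / p)) \<partial>\<nu>)"
  proof (rule strictly_absolutely_monotonic_integral[OF finite_measure_nu measurable_reciprocal reciprocal_bounds])
    show "AE p in \<nu>. 0 < real_of_ereal (1 / p)"
      using AE_finite_exponent AE_space
    proof eventually_elim
      case (elim p)
      then show ?case using nu_ge_1[of p] by (cases p) (auto simp: one_ereal_def)
    qed
    show "emeasure \<nu> (space \<nu>) \<noteq> 0" using nu_nonzero by (simp add: space_nu)
  qed
  moreover have "zeta M \<nu> Q = (\<lambda>s. \<integral>p. exp (s * real_of_ereal (1 / p)) \<partial>\<nu>)"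
    unfolding zeta_eq[abs_def] by (intro ext Bochner_Integration.integral_cong refl exp_div_nu)
  ultimately show ?thesis by simp
qed

lemma exponential_bounds_zeta: "exponential_bounds a b (zeta M \<nu> Q)"
proof -
  let ?m = "measure \<nu> (space \<nu>)"
  have m: "0 < ?m"
    using nu_nonzero by (simp add: space_nu[symmetric] emeasure_nu zero_less_measure_iff)
  have le: "real_of_ereal (1 / b) \<le> real_of_ereal (1 / p)" "real_of_ereal (1 / p) \<le> real_of_ereal (1 / a)"
    if "p \<in> space \<nu>" for p
    using that endpoints(1) unfolding space_nu
    by (cases p; cases a; cases b; auto simp: one_ereal_def frac_le)+
  have ab: "a \<in> space \<nu>" "b \<in> space \<nu>" using endpoints(2) by (auto simp: space_nu)
  have bounds: "?m * c \<le> zeta M \<nu> Q s" if "\<And>p. p \<in> space \<nu> \<Longrightarrow> c \<le> exp_div s p" for c s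
  proof -
    have "(\<integral>p. c \<partial>\<nu>) \<le> (\<integral>p. exp_div s p \<partial>\<nu>)"
      using that by (intro integral_mono integrable_exp_div finite_measure.integrable_const[OF finite_measure_nu]) auto
    then show ?thesis by (simp add: zeta_eq)
  qed
  have bounds': "zeta M \<nu> Q s \<le> ?m * c" if "\<And>p. p \<in> space \<nu> \<Longrightarrow> exp_div s p \<le> c" for c s
  proof -
    have "(\<integral>p. exp_div s p \<partial>\<nu>) \<le> (\<integral>p. c \<partial>\<nu>)"
      using that by (intro integral_mono integrable_exp_div finite_measure.integrable_const[OF finite_measure_nu]) auto
    then show ?thesis by (simp add: zeta_eq)
  qed
  show ?thesis
    unfolding exponential_bounds_def
  proof (intro exI[of _ ?m] conjI allI impI)
    fix s :: real assume s: "0 \<le> s"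
    show "?m * exp_div s b \<le> zeta M \<nu> Q s"
      using s le ab by (intro bounds) (simp add: exp_div_nu mult_left_mono)
    show "zeta M \<nu> Q s \<le> ?m * exp_div s a"
      using s le ab by (intro bounds') (simp add: exp_div_nu mult_left_mono)
  next
    fix s :: real assume s: "s \<le> 0"
    show "?m * exp_div s a \<le> zeta M \<nu> Q s"
      using s le ab by (intro bounds) (simp add: exp_div_nu mult_left_mono_neg)
    show "zeta M \<nu> Q s \<le> ?m * exp_div s b"
      using s le ab by (intro bounds') (simp add: exp_div_nu mult_left_mono_neg)
  qed (rule m)+
qed

end

section \<open>The characterisation of the functions \<open>\<zeta>\<close>\<close>

theorem theorem5p1:
  fixes a b :: ereal
  assumes "1 \<le> a" and "a < b"
  shows
    "(\<forall>(M :: 't measure) \<nu> Q.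
        integral_grand_lebesgue M \<nu> Q a b \<longrightarrow> emeasure \<nu> {a..b} < \<infinity> \<longrightarrow>
          (\<forall>s. epowr (fundamental_function M \<nu> Q (exp (s / Q))) Q
                 = ennreal (\<integral>p. exp_div s p \<partial>\<nu>)) \<and>
          (\<forall>s. zeta M \<nu> Q s = (\<integral>p. exp_div s p \<partial>\<nu>)) \<and>
          strictly_absolutely_monotonic (zeta M \<nu> Q) \<and>
          exponential_bounds a b (zeta M \<nu> Q))
     \<and> (\<forall>\<zeta>\<in>AM a b. smooth_on_line \<zeta>)
     \<and> (\<forall>\<zeta>\<in>AM a b. \<exists>\<nu>. borel_measure_on {a..b} \<nu> \<and> finite_measure \<nu> \<and>
           (\<forall>s. integrable \<nu> (exp_div s) \<and> \<zeta> s = (\<integral>p. exp_div s p \<partial>\<nu>)))"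
proof (intro conjI)
  show "\<forall>(M :: 't measure) \<nu> Q.
        integral_grand_lebesgue M \<nu> Q a b \<longrightarrow> emeasure \<nu> {a..b} < \<infinity> \<longrightarrow>
          (\<forall>s. epowr (fundamental_function M \<nu> Q (exp (s / Q))) Q
                 = ennreal (\<integral>p. exp_div s p \<partial>\<nu>)) \<and>
          (\<forall>s. zeta M \<nu> Q s = (\<integral>p. exp_div s p \<partial>\<nu>)) \<and>
          strictly_absolutely_monotonic (zeta M \<nu> Q) \<and>
          exponential_bounds a b (zeta M \<nu> Q)"
  proof (intro allI impI)
    fix M :: "'t measure" and \<nu> Q
    assume *: "integral_grand_lebesgue M \<nu> Q a b" "emeasure \<nu> {a..b} < \<infinity>"
    show "(\<forall>s. epowr (fundamental_function M \<nu> Q (exp (s / Q))) Q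
                 = ennreal (\<integral>p. exp_div s p \<partial>\<nu>)) \<and>
          (\<forall>s. zeta M \<nu> Q s = (\<integral>p. exp_div s p \<partial>\<nu>)) \<and>
          strictly_absolutely_monotonic (zeta M \<nu> Q) \<and>
          exponential_bounds a b (zeta M \<nu> Q)"
      using fundamental_function_powr[OF *] zeta_eq[OF *]
        strictly_absolutely_monotonic_zeta[OF *] exponential_bounds_zeta[OF *] by blast
  qed
  show "\<forall>\<zeta>\<in>AM a b. smooth_on_line \<zeta>"
    unfolding AM_def strictly_absolutely_monotonic_def smooth_on_line_def
    by (auto intro: differentiable_at_imp_differentiable_on)
  show "\<forall>\<zeta>\<in>AM a b. \<exists>\<nu>. borel_measure_on {a..b} \<nu> \<and> finite_measure \<nu> \<and>
           (\<forall>s. integrable \<nu> (exp_div s) \<and> \<zeta> s = (\<integral>p. exp_div s p \<partial>\<nu>))"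
    using AM_representation[OF assms] by metis
qed

end
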